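(* Let $A$ be a unique factorization domain which is also a $\mathbb Q$-algebra. Let $a\in A$ and let $D:=\partial_t-a$, viewed as an $A$-linear map $A[t]\to A[t]$. Then $\mathrm{Im}\,D=D(A[t])$ is a Mathieu subspace of $A[t]$.
   Context: $\partial_t$ is the formal derivative with respect to $t$ on $A[t]$, so $D(f)=\partial_t f-af$. For a subset $V$ of a commutative algebra $B$, $\mathfrak r(V)=\{f\in B : f^m\in V\text{ for all sufficiently large } m\}$. A submodule $V$ of $B$ (over the base ring; here $B=A[t]$ as an $A$-algebra) is a Mathieu subspace of $B$ if for every $f\in\mathfrak r(V)$ and every $g\in B$ there exists $N$ such that $f^m g\in V$ for all $m\ge N$. *)

theory Defs
  imports "HOL-Computational_Algebra.Computational_Algebra"
begin

definition radical_set :: "'b::comm_ring_1 set \<Rightarrow> 'b set"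
  where "radical_set V = {f. \<exists>N. \<forall>m\<ge>N. f ^ m \<in> V}"

text \<open>
  Commutative unital algebras over a commutative ring, as a module whose scalar
  multiplication is compatible with the product (the product being commutative,
  compatibility in one argument suffices).
\<close>

locale commutative_algebra = module scale
  for scale :: "'r::comm_ring_1 \<Rightarrow> 'b::comm_ring_1 \<Rightarrow> 'b" +
  assumes scale_mult_left: "scale r (x * y) = scale r x * y"
begin

definition mathieu_subspace :: "'b set \<Rightarrow> bool"
  where "mathieu_subspace V \<longleftrightarrow>
    subspace V \<and> (\<forall>f \<in> radical_set V. \<forall>g. \<exists>N. \<forall>m\<ge>N. f ^ m * g \<in> V)"

end

lemma commutative_algebra_smult:
  "commutative_algebra (smult :: 'a::comm_ring_1 \<Rightarrow> 'a poly \<Rightarrow> 'a poly)"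
  by unfold_locales (simp_all add: smult_add_right smult_add_left)

definition deriv_minus :: "'a::idom \<Rightarrow> 'a poly \<Rightarrow> 'a poly"
  where "deriv_minus a f = pderiv f - smult a f"

lemma module_hom_deriv_minus: "module_hom smult smult (deriv_minus a)"
proof -
  interpret commutative_algebra "smult :: 'a \<Rightarrow> 'a poly \<Rightarrow> 'a poly"
    by (rule commutative_algebra_smult)
  show ?thesis
    by unfold_locales
       (simp_all add: deriv_minus_def pderiv_add pderiv_smult smult_add_right
          smult_diff_right mult.commute)
qed

end

theory Submission
  imports Defs
begin

text \<open>
  Write \<open>E\<close> for the functional \<open>s^i \<mapsto> i!\<close>. If \<open>a = 0\<close>, the operator is the derivative, which is
  onto over a \<open>\<rat>\<close>-algebra. If \<open>a \<noteq> 0\<close>, the operator is invertible over the fraction field, and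
  \<open>g\<close> lies in its image over \<open>A\<close> exactly when the Laplace transform
  \<open>\<Sum>\<^sub>i i! g\<^sub>i / a^(i+1) = E(g(s/a)) / a\<close> lies in \<open>A\<close>. With denominators cleared, this says that
  \<open>a^(n+1)\<close> divides \<open>E(a^n g(s/a))\<close> for \<open>n \<ge> deg g\<close> (\<open>range_deriv_minus_imp_dvd\<close>,
  \<open>dvd_imp_range_deriv_minus\<close>). Since \<open>g \<mapsto> a^n g(s/a)\<close> is multiplicative, powers of \<open>f\<close> become
  powers of \<open>F = a^d f(s/a)\<close>, where \<open>d = deg f\<close>.

  Suppose that all high powers of \<open>f\<close> lie in the image, and let \<open>p\<close> be a prime that divides \<open>a\<close>
  exactly \<open>e\<close> times. Then \<open>p^(d e + 1)\<close> divides \<open>F\<close> (\<open>prime_power_dvd_rescale\<close>); in other words,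
  \<open>f(s/a)\<close> is \<open>p\<close>-integral and vanishes modulo \<open>p\<close>. For if not, removing the exact power of \<open>p\<close> from
  \<open>F\<close> leaves a polynomial \<open>G\<close> that is nonzero modulo \<open>p\<close> although \<open>E(G^m) \<equiv> 0\<close> modulo \<open>p\<close> for all
  large \<open>m\<close>. As this happens at every prime of \<open>a\<close>, a high power \<open>f^m\<close> has enough spare factors to
  keep \<open>f^m g\<close> in the image for any fixed \<open>g\<close>.

  The core is therefore the one-variable factorial conjecture over the domain \<open>A/p\<close> of
  characteristic zero (\<open>factorial_functional_powers\<close>): if \<open>E(G^m) = 0\<close> for all large \<open>m\<close>, then
  \<open>G = 0\<close>. Write \<open>G = s^r h\<close> with \<open>h(0) \<noteq> 0\<close>. For a prime number \<open>l\<close>, the Frobenius congruence gives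
  \<open>E(G^l) = (r l)! (h(0)^l - l y)\<close> with \<open>y\<close> in the ring \<open>R\<close> generated by the coefficients of \<open>G\<close>. So
  \<open>h(0)^l\<close> lies in \<open>l R\<close> for all large \<open>l\<close>. This is impossible in a finitely generated domain of
  characteristic zero: a nonzero element lies in the radical of \<open>l R\<close> only for finitely many primes
  \<open>l\<close> (\<open>prime_separated_generators\<close>). That statement is proved by adding one generator at a time,
  starting from the integers. All computations in \<open>A/p\<close> are carried out in \<open>A\<close>, as congruences
  modulo \<open>p\<close>.
\<close>

section \<open>Subrings and polynomials with coefficients in them\<close>

definition unital_subring :: "'a::comm_ring_1 set \<Rightarrow> bool"
  where "unital_subring R \<longleftrightarrow> 1 \<in> R \<and> (\<forall>x\<in>R. \<forall>y\<in>R. x - y \<in> R \<and> x * y \<in> R)"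

definition polys_over :: "'a::comm_ring_1 set \<Rightarrow> 'a poly set"
  where "polys_over R = {g. \<forall>i. coeff g i \<in> R}"

definition adjoin :: "'a::comm_ring_1 set \<Rightarrow> 'a \<Rightarrow> 'a set"
  where "adjoin R x = (\<lambda>g. poly g x) ` polys_over R"

lemma unital_subring_closed:
  assumes "unital_subring R"
  shows "0 \<in> R" "1 \<in> R"
    and "x \<in> R \<Longrightarrow> y \<in> R \<Longrightarrow> x - y \<in> R"
    and "x \<in> R \<Longrightarrow> y \<in> R \<Longrightarrow> x * y \<in> R"
    and "x \<in> R \<Longrightarrow> - x \<in> R"
    and "x \<in> R \<Longrightarrow> y \<in> R \<Longrightarrow> x + y \<in> R"
proof -
  note R = assms[unfolded unital_subring_def]
  show zero: "0 \<in> R" using R by (metis diff_self)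
  show "1 \<in> R" and "x \<in> R \<Longrightarrow> y \<in> R \<Longrightarrow> x - y \<in> R"
    and "x \<in> R \<Longrightarrow> y \<in> R \<Longrightarrow> x * y \<in> R"
    using R by auto
  show minus: "x \<in> R \<Longrightarrow> - x \<in> R" for x using R zero by (metis diff_0)
  show "x \<in> R \<Longrightarrow> y \<in> R \<Longrightarrow> x + y \<in> R"
    using R minus by (metis diff_minus_eq_add)
qed

lemma unital_subring_power: "unital_subring R \<Longrightarrow> x \<in> R \<Longrightarrow> x ^ n \<in> R"
  by (induction n) (auto simp: unital_subring_closed)

lemma unital_subring_sum:
  "unital_subring R \<Longrightarrow> (\<And>i. i \<in> I \<Longrightarrow> f i \<in> R) \<Longrightarrow> sum f I \<in> R"
  by (induction I rule: infinite_finite_induct) (auto simp: unital_subring_closed)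

lemma unital_subring_of_nat: "unital_subring R \<Longrightarrow> of_nat n \<in> R"
  by (induction n) (auto simp: unital_subring_closed)

lemma unital_subring_of_int: "unital_subring R \<Longrightarrow> of_int n \<in> R"
  by (cases n rule: int_diff_cases) (auto simp: unital_subring_closed unital_subring_of_nat)

lemma unital_subring_polys_over:
  assumes "unital_subring R"
  shows "unital_subring (polys_over R)"
  unfolding unital_subring_def[of "polys_over R"]
  using assms by (auto simp: polys_over_def coeff_mult unital_subring_closed
      intro!: unital_subring_sum)

lemma polys_over_const:
  assumes "unital_subring R" "c \<in> R"
  shows "[:c:] \<in> polys_over R"
  using assms by (auto simp: polys_over_def coeff_pCons unital_subring_closed split: nat.split)

lemma polys_over_smult:
  assumes "unital_subring R" "c \<in> R" "g \<in> polys_over R"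
  shows "smult c g \<in> polys_over R"
  using assms by (auto simp: polys_over_def unital_subring_closed)

lemma polys_over_monom:
  assumes "unital_subring R" "c \<in> R"
  shows "monom c n \<in> polys_over R"
  using assms by (auto simp: polys_over_def unital_subring_closed)

lemma polys_over_pderiv:
  assumes "unital_subring R" "g \<in> polys_over R"
  shows "pderiv g \<in> polys_over R"
  using assms unital_subring_of_nat[of R "Suc _"]
  by (auto simp: polys_over_def coeff_pderiv intro!: unital_subring_closed(4))

lemma polys_over_coeff: "g \<in> polys_over R \<Longrightarrow> coeff g i \<in> R"
  by (simp add: polys_over_def)

lemma unital_subring_adjoin:
  assumes "unital_subring R"
  shows "unital_subring (adjoin R x)"
proof -
  note P = unital_subring_polys_over[OF assms]
  show ?thesis
    unfolding unital_subring_def adjoin_def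
    using unital_subring_closed(2-4)[OF P]
    by (auto simp flip: poly_diff poly_mult poly_1 intro!: imageI)
      (metis imageI poly_1)
qed

lemma adjoin_superset:
  assumes "unital_subring R"
  shows "insert x R \<subseteq> adjoin R x"
proof -
  have "x = poly (monom 1 1) x" and "\<And>c. c = poly [:c:] x" by (auto simp: poly_monom)
  moreover have "monom 1 1 \<in> polys_over R" "\<And>c. c \<in> R \<Longrightarrow> [:c:] \<in> polys_over R"
    using assms by (auto intro: polys_over_monom polys_over_const unital_subring_closed)
  ultimately show ?thesis unfolding adjoin_def by blast
qed

text \<open>
  Division by a polynomial that is not monic succeeds once the dividend is multiplied by a power
  of the leading coefficient. What matters below is that quotient and remainder keep their
  coefficients in the subring.
\<close>
lemma pseudo_division_over:
  fixes f g :: "'a::idom poly"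
  assumes R: "unital_subring R" and g: "g \<in> polys_over R" "0 < degree g"
    and f: "f \<in> polys_over R"
  shows "\<exists>e q r. q \<in> polys_over R \<and> r \<in> polys_over R \<and>
           smult (lead_coeff g ^ e) f = q * g + r \<and> degree r < degree g"
  using f
proof (induction "degree f" arbitrary: f rule: less_induct)
  case less
  note P = unital_subring_polys_over[OF R]
  show ?case
  proof (cases "degree f < degree g")
    case True
    then show ?thesis
      using less.prems unital_subring_closed(1)[OF P]
      by (intro exI[of _ 0] exI[of _ "0 :: 'a poly"] exI[of _ f]) auto
  next
    case False
    define u where "u = monom (lead_coeff f) (degree f - degree g)"
    define f1 where "f1 = smult (lead_coeff g) f - u * g"
    have u: "u \<in> polys_over R"
      unfolding u_def using R less.prems by (intro polys_over_monom polys_over_coeff)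
    have f1: "f1 \<in> polys_over R"
      unfolding f1_def
      using R g less.prems u by (intro unital_subring_closed[OF P] polys_over_smult polys_over_coeff)
    have "degree f1 < degree f"
    proof -
      have "degree (u * g) \<le> degree f"
        using False degree_mult_le[of u g] degree_monom_le[of "lead_coeff f" "degree f - degree g"]
        unfolding u_def by linarith
      then have "degree f1 \<le> degree f"
        unfolding f1_def by (intro degree_diff_le) auto
      moreover have "coeff f1 (degree f) = 0"
        using False by (simp add: f1_def u_def coeff_monom_mult)
      ultimately show ?thesis
        using eq_zero_or_degree_less[of f1 "degree f"] False g(2) by auto
    qed
    from less.hyps[OF this f1] obtain e q r where
      qr: "q \<in> polys_over R" "r \<in> polys_over R"
        "smult (lead_coeff g ^ e) f1 = q * g + r" "degree r < degree g"
      by blast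
    have "smult (lead_coeff g ^ Suc e) f = (q + smult (lead_coeff g ^ e) u) * g + r"
      using qr(3) by (simp add: f1_def smult_diff_right algebra_simps)
    moreover have "q + smult (lead_coeff g ^ e) u \<in> polys_over R"
      using R g qr(1) u
      by (intro unital_subring_closed[OF P] polys_over_smult unital_subring_power polys_over_coeff)
    ultimately show ?thesis using qr by blast
  qed
qed

lemma const_dvd_imp_dvd_poly: "[:p:] dvd g \<Longrightarrow> p dvd poly g (x :: 'a::comm_ring_1)"
  by (auto elim!: dvdE)

text \<open>
  Modulo \<open>p\<close>, a polynomial may be replaced by one whose leading coefficient survives: top terms
  divisible by \<open>p\<close> are removed one at a time. This is what makes degree arguments in
  \<open>(A/p)[x]\<close> possible while all polynomials stay over \<open>A\<close>.
\<close>
lemma truncate_top: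
  fixes h :: "'a::idom poly"
  assumes R: "unital_subring R" and "h \<in> polys_over R" and "\<not> [:p:] dvd h"
  shows "\<exists>h'\<in>polys_over R. degree h' \<le> degree h \<and> \<not> p dvd lead_coeff h' \<and> [:p:] dvd h - h'"
  using assms(2,3)
proof (induction "degree h" arbitrary: h rule: less_induct)
  case less
  show ?case
  proof (cases "p dvd lead_coeff h")
    case False
    then show ?thesis using less.prems by auto
  next
    case True
    define u where "u = monom (lead_coeff h) (degree h)"
    have pu: "[:p:] dvd u" using True by (auto simp: u_def const_poly_dvd_iff)
    have pos: "degree h \<noteq> 0"
    proof
      assume "degree h = 0"
      then have "u = h" by (metis u_def degree_0_id monom_0)
      then show False using pu less.prems by simp
    qed
    have "degree (h - u) \<le> degree h"
      by (intro degree_diff_le) (auto simp: u_def degree_monom_le)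
    moreover have "coeff (h - u) (degree h) = 0" by (simp add: u_def)
    ultimately have deg: "degree (h - u) < degree h"
      using eq_zero_or_degree_less[of "h - u" "degree h"] pos by auto
    have "h - u \<in> polys_over R"
      unfolding u_def using R less.prems
      by (intro unital_subring_closed(3)[OF unital_subring_polys_over] polys_over_monom polys_over_coeff)
    moreover have "\<not> [:p:] dvd h - u"
      using pu less.prems(2) by (metis dvd_add diff_add_cancel)
    ultimately obtain h' where h': "h' \<in> polys_over R" "degree h' \<le> degree (h - u)"
        "\<not> p dvd lead_coeff h'" "[:p:] dvd h - u - h'"
      using less.hyps[OF deg] by blast
    have "[:p:] dvd h - h'"
      using dvd_add[OF h'(4) pu] by (simp add: algebra_simps)
    then show ?thesis using h' deg by (intro bexI[of _ h']) auto
  qed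
qed

section \<open>Elements outside the radical of almost all rational primes\<close>

text \<open>
  In the quotient of \<open>R\<close> by \<open>R \<inter> pA\<close>, this says that no nonzero element lies in the radical of
  \<open>(l)\<close> for infinitely many primes \<open>l\<close>. Allowing arbitrary powers of \<open>b\<close> makes the property
  pass to a larger ring when one generator is added.
\<close>
definition prime_separated :: "'a::comm_ring_1 \<Rightarrow> 'a set \<Rightarrow> bool"
  where "prime_separated p R \<longleftrightarrow> (\<forall>b\<in>R. \<not> p dvd b \<longrightarrow>
    (\<exists>M. \<forall>l>M. prime l \<longrightarrow> (\<forall>n. \<forall>y\<in>R. \<not> p dvd b ^ n - of_nat l * y)))"

lemma prime_separated_integers:
  fixes p :: "'a::comm_ring_1"
  assumes p: "\<And>n. n > 0 \<Longrightarrow> \<not> p dvd of_nat n"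
  shows "prime_separated p (range of_int)"
  unfolding prime_separated_def
proof (intro ballI impI)
  have *: "z = 0" if "p dvd of_int z" for z
  proof (rule ccontr)
    assume "z \<noteq> 0"
    then have "\<not> p dvd of_nat (nat \<bar>z\<bar>)" by (intro p) auto
    then have "\<not> p dvd of_int \<bar>z\<bar>" by simp
    then show False using that by (cases "z \<ge> 0") auto
  qed
  fix b :: 'a
  assume "b \<in> range of_int" "\<not> p dvd b"
  then obtain c where c: "b = of_int c" by blast
  with \<open>\<not> p dvd b\<close> have c0: "c \<noteq> 0" by auto
  show "\<exists>M. \<forall>l>M. prime l \<longrightarrow> (\<forall>n. \<forall>y\<in>range of_int. \<not> p dvd b ^ n - of_nat l * y)"
  proof (intro exI[of _ "nat \<bar>c\<bar>"] allI impI ballI notI)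
    fix l n y assume l: "nat \<bar>c\<bar> < l" "prime l" and y: "y \<in> range of_int"
      and dvd: "p dvd b ^ n - of_nat l * y"
    obtain z where z: "y = of_int z" using y by blast
    have "p dvd of_int (c ^ n - int l * z)" using dvd by (simp add: c z)
    from *[OF this] have "int l dvd c ^ n" by simp
    then have "int l dvd c" using l by (metis prime_dvd_power prime_nat_int_transfer)
    then show False using l c0 dvd_imp_le_int[of c "int l"] by auto
  qed
qed

text \<open>
  If \<open>x\<close> is algebraic over \<open>R\<close> modulo \<open>p\<close>, with \<open>P\<close> playing the role of a minimal polynomial,
  every nonzero element \<open>b\<close> of \<open>R[x]/p\<close> has a nonzero multiple in \<open>R\<close>. Take a nonzero multiple
  \<open>h(x)\<close> of \<open>b\<close> with \<open>h\<close> of least degree. Division by \<open>P\<close> gives \<open>deg h < deg P\<close>. If \<open>h\<close> were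
  not constant, dividing \<open>P\<close> by \<open>h\<close> would leave a remainder whose value is again a multiple of
  \<open>b\<close>, hence zero, and \<open>P\<close> would factor modulo \<open>p\<close> although it is minimal.
\<close>
lemma nonzero_multiple_in_base:
  fixes p x b :: "'a::idom"
  assumes R: "unital_subring R" and p: "prime_elem p"
    and P: "P \<in> polys_over R" "p dvd poly P x" "\<not> p dvd lead_coeff P"
    and min: "\<And>h. h \<in> polys_over R \<Longrightarrow> p dvd poly h x \<Longrightarrow> degree h < degree P \<Longrightarrow> [:p:] dvd h"
    and b: "b \<in> adjoin R x" "\<not> p dvd b"
  shows "\<exists>b0\<in>R. \<exists>u\<in>adjoin R x. \<not> p dvd b0 \<and> p dvd b0 - u * b"
proof -
  note S = unital_subring_polys_over[OF R] and T = unital_subring_adjoin[OF R, of x]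
  define good where "good h \<longleftrightarrow> h \<in> polys_over R \<and> \<not> p dvd poly h x \<and>
    (\<exists>u\<in>adjoin R x. p dvd poly h x - u * b)" for h
  have P_pos: "0 < degree P"
  proof (rule ccontr)
    assume "\<not> 0 < degree P"
    then have "poly P x = lead_coeff P" by (metis degree_0_id gr0I mult_zero_right add_0_right poly_0 poly_pCons)
    then show False using P by simp
  qed
  have "\<exists>h. good h"
  proof -
    obtain g where "g \<in> polys_over R" "b = poly g x" using b by (auto simp: adjoin_def)
    then have "good g"
      using b unital_subring_closed(2)[OF T] by (auto simp: good_def intro!: bexI[of _ 1])
    then show ?thesis by blast
  qed
  then obtain h0 where h0: "good h0" "\<And>h. good h \<Longrightarrow> degree h0 \<le> degree h"
    using ex_has_least_nat[of good _ degree] by blast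
  then have "\<not> [:p:] dvd h0"
    using const_dvd_imp_dvd_poly by (auto simp: good_def)
  then obtain h where h: "h \<in> polys_over R" "degree h \<le> degree h0" "\<not> p dvd lead_coeff h"
      "[:p:] dvd h0 - h"
    using truncate_top[OF R] h0(1) by (metis good_def)
  have h0h: "p dvd poly h0 x - poly h x"
    using const_dvd_imp_dvd_poly[OF h(4), of x] by simp
  obtain u where u: "u \<in> adjoin R x" "p dvd poly h0 x - u * b"
    using h0(1) by (auto simp: good_def)
  have hu: "p dvd poly h x - u * b"
    using dvd_diff[OF u(2) h0h] by simp
  have hx: "\<not> p dvd poly h x"
    using h0(1) h0h dvd_add[OF h0h, of "poly h x"] by (auto simp: good_def)
  have least: "degree h \<le> degree g" if "good g" for g
    using h0(2)[OF that] h(2) by linarith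
  \<comment> \<open>Minimality of h: a multiple of h(x) that is the value of a polynomial of lower degree
    vanishes modulo p.\<close>
  have no_smaller: "p dvd poly r x"
    if r: "r \<in> polys_over R" "degree r < degree h"
      and q: "q \<in> polys_over R" "p dvd poly r x - poly q x * poly h x" for r q
  proof (rule ccontr)
    assume "\<not> p dvd poly r x"
    moreover have "poly q x * u \<in> adjoin R x"
      using q u unital_subring_closed(4)[OF T] by (auto simp: adjoin_def)
    moreover have "p dvd poly r x - (poly q x * u) * b"
    proof -
      have "poly r x - (poly q x * u) * b =
        (poly r x - poly q x * poly h x) + poly q x * (poly h x - u * b)"
        by (simp add: algebra_simps)
      then show ?thesis using q hu by (metis dvd_add dvd_mult)
    qed
    ultimately have "good r" using r by (auto simp: good_def)
    then show False using least r by fastforce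
  qed
  have "degree h < degree P"
  proof (rule ccontr)
    assume le: "\<not> degree h < degree P"
    obtain e q r where qr: "q \<in> polys_over R" "r \<in> polys_over R"
        "smult (lead_coeff P ^ e) h = q * P + r" "degree r < degree P"
      using pseudo_division_over[OF R P(1) P_pos h(1)] by blast
    let ?c = "lead_coeff P ^ e"
    have "?c * poly h x = poly q x * poly P x + poly r x"
      using arg_cong[OF qr(3), of "\<lambda>g. poly g x"] by simp
    then have eq: "poly r x - poly [:?c:] x * poly h x = - (poly q x * poly P x)"
      by (simp add: algebra_simps)
    have "[:?c:] \<in> polys_over R"
      using P(1) R by (intro polys_over_const unital_subring_power polys_over_coeff)
    moreover have "p dvd poly r x - poly [:?c:] x * poly h x"
      unfolding eq using P(2) by simp
    ultimately have "p dvd poly r x"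
      using no_smaller[OF qr(2)] qr(4) le by simp
    then have "p dvd ?c * poly h x"
      using \<open>?c * poly h x = _\<close> P(2) by simp
    then show False
      using p hx P(3) by (metis prime_elem_dvd_mult_iff prime_elem_dvd_power)
  qed
  have "degree h = 0"
  proof (rule ccontr)
    assume pos: "degree h \<noteq> 0"
    obtain e q r where qr: "q \<in> polys_over R" "r \<in> polys_over R"
        "smult (lead_coeff h ^ e) P = q * h + r" "degree r < degree h"
      using pseudo_division_over[OF R h(1) _ P(1)] pos by blast
    let ?c = "lead_coeff h ^ e"
    have c: "\<not> p dvd ?c" using h(3) p by (metis prime_elem_dvd_power)
    then have c0: "?c \<noteq> 0" by (metis dvd_0_right)
    have eq: "?c * poly P x = poly q x * poly h x + poly r x"
      using arg_cong[OF qr(3), of "\<lambda>g. poly g x"] by simp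
    then have "poly r x - poly (- q) x * poly h x = ?c * poly P x" by simp
    then have r: "p dvd poly r x"
      using no_smaller[OF qr(2,4), of "- q"] P(2) qr(1) unital_subring_closed(5)[OF S] by simp
    then have pr: "[:p:] dvd r"
      using min qr \<open>degree h < degree P\<close> by simp
    have "p dvd poly q x * poly h x"
      using eq r P(2) by (metis dvd_add_left_iff dvd_mult)
    then have pq: "p dvd poly q x" using p hx by (simp add: prime_elem_dvd_mult_iff)
    have "q \<noteq> 0"
    proof
      assume "q = 0"
      then have "degree (smult ?c P) = degree r" using qr(3) by simp
      moreover have "degree (smult ?c P) = degree P" using c0 by (metis degree_smult_eq)
      ultimately show False using qr(4) \<open>degree h < degree P\<close> by linarith
    qed
    moreover have "h \<noteq> 0" using hx by auto
    \<comment> \<open>The degree of the factor q is below that of P, and q vanishes at x modulo p,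
      so q is zero modulo p; this is incompatible with the leading coefficient of P.\<close>
    moreover have "degree (q * h) = degree P"
    proof -
      have "degree (q * h + r) = degree P" using c0 qr(3) by (metis degree_smult_eq)
      moreover have "degree (q * h) \<ge> degree h" using \<open>q \<noteq> 0\<close> \<open>h \<noteq> 0\<close> by (simp add: degree_mult_eq)
      then have "degree (q * h + r) = degree (q * h)" using qr(4) by (intro degree_add_eq_left) linarith
      ultimately show ?thesis by simp
    qed
    ultimately have "degree q < degree P"
      using pos by (simp add: degree_mult_eq)
    then have "[:p:] dvd q" using min qr(1) pq by blast
    then have "[:p:] dvd smult ?c P" unfolding qr(3) using pr by simp
    then have "p dvd ?c * lead_coeff P" by (simp add: const_poly_dvd_iff)
    then show False using c P(3) p by (simp add: prime_elem_dvd_mult_iff)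
  qed
  then have "poly h x = coeff h 0"
    by (metis degree_0_id mult_zero_right add_0_right poly_0 poly_pCons)
  then show ?thesis
    using hx hu u h(1) polys_over_coeff by metis
qed

text \<open>
  If \<open>x\<close> is transcendental over \<open>R\<close> modulo \<open>p\<close>, comparing leading coefficients in
  \<open>b^n \<equiv> l y\<close> gives the same kind of congruence for the leading coefficient of \<open>b\<close>, which lies
  in \<open>R\<close>. If \<open>x\<close> is algebraic with minimal polynomial of leading coefficient \<open>c\<close>, then after
  inverting \<open>c\<close> the ring is free on \<open>1, x, ..., x^(d-1)\<close> over \<open>R[1/c]\<close>. So replace \<open>b\<close> by a multiple
  \<open>b0\<close> in \<open>R\<close>, clear the denominators, and compare constant terms: \<open>c b0\<close> would lie in the
  radical of \<open>(l)\<close> in \<open>R\<close>.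
\<close>
lemma prime_separated_adjoin:
  fixes p x :: "'a::idom"
  assumes R: "unital_subring R" and p: "prime_elem p" and sep: "prime_separated p R"
  shows "prime_separated p (adjoin R x)"
  unfolding prime_separated_def
proof (intro ballI impI)
  note S = unital_subring_polys_over[OF R] and T = unital_subring_adjoin[OF R, of x]
  let ?sep = "\<lambda>b. \<exists>M. \<forall>l>M. prime l \<longrightarrow> (\<forall>n. \<forall>y\<in>adjoin R x. \<not> p dvd b ^ n - of_nat l * y)"
  fix b assume b: "b \<in> adjoin R x" "\<not> p dvd b"
  show "?sep b"
  proof (cases "\<forall>h\<in>polys_over R. p dvd poly h x \<longrightarrow> [:p:] dvd h")
    case True
    obtain g0 where g0: "g0 \<in> polys_over R" "b = poly g0 x" using b by (auto simp: adjoin_def)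
    then have "\<not> [:p:] dvd g0" using b const_dvd_imp_dvd_poly by blast
    then obtain g where g: "g \<in> polys_over R" "\<not> p dvd lead_coeff g" "[:p:] dvd g0 - g"
      using truncate_top[OF R g0(1)] by blast
    obtain M where M: "\<And>l n y. M < l \<Longrightarrow> prime l \<Longrightarrow> y \<in> R \<Longrightarrow> \<not> p dvd lead_coeff g ^ n - of_nat l * y"
      using sep g polys_over_coeff unfolding prime_separated_def by metis
    show ?thesis
    proof (intro exI[of _ M] allI impI ballI notI)
      fix l n y assume l: "M < l" "prime l" and y: "y \<in> adjoin R x" and dvd: "p dvd b ^ n - of_nat l * y"
      obtain h where h: "h \<in> polys_over R" "y = poly h x" using y by (auto simp: adjoin_def)
      define w where "w = g0 ^ n - smult (of_nat l) h"
      have "w \<in> polys_over R"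
        unfolding w_def using R g0 h
        by (intro unital_subring_closed(3)[OF S] unital_subring_power[OF S] polys_over_smult unital_subring_of_nat)
      moreover have "p dvd poly w x" using dvd by (simp add: w_def g0 h)
      ultimately have "[:p:] dvd w" using True by blast
      moreover have "[:p:] dvd g0 ^ n - g ^ n"
        using g(3) by (metis dvd_trans dvd_triv_left power_diff_sumr2)
      ultimately have "[:p:] dvd w - (g0 ^ n - g ^ n)" by (rule dvd_diff)
      then have "[:p:] dvd g ^ n - smult (of_nat l) h" by (simp add: w_def)
      then have "p dvd coeff (g ^ n - smult (of_nat l) h) (degree (g ^ n))"
        by (simp add: const_poly_dvd_iff)
      then have "p dvd lead_coeff g ^ n - of_nat l * coeff h (degree (g ^ n))"
        by (simp add: lead_coeff_power)
      then show False using M l h(1) polys_over_coeff by blast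
    qed
  next
    case False
    define bad where "bad h \<longleftrightarrow> h \<in> polys_over R \<and> p dvd poly h x \<and> \<not> [:p:] dvd h" for h
    obtain P0 where P0: "bad P0" "\<And>h. bad h \<Longrightarrow> degree P0 \<le> degree h"
      using False ex_has_least_nat[of bad _ degree] unfolding bad_def by blast
    obtain P where P: "P \<in> polys_over R" "degree P \<le> degree P0" "\<not> p dvd lead_coeff P" "[:p:] dvd P0 - P"
      using truncate_top[OF R, of P0 p] P0(1) by (auto simp: bad_def)
    have Px: "p dvd poly P x"
      using dvd_diff[OF _ const_dvd_imp_dvd_poly[OF P(4), of x], of "poly P0 x"] P0(1) by (simp add: bad_def)
    have min: "[:p:] dvd h" if "h \<in> polys_over R" "p dvd poly h x" "degree h < degree P" for h
      using P0(2)[of h] that P(2) by (fastforce simp: bad_def)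
    have P_pos: "0 < degree P"
    proof (rule ccontr)
      assume "\<not> 0 < degree P"
      then have "poly P x = lead_coeff P" by (metis degree_0_id gr0I mult_zero_right add_0_right poly_0 poly_pCons)
      then show False using P Px by simp
    qed
    obtain b0 u where b0: "b0 \<in> R" "u \<in> adjoin R x" "\<not> p dvd b0" "p dvd b0 - u * b"
      using nonzero_multiple_in_base[OF R p P(1) Px P(3) min b] by blast
    let ?c = "lead_coeff P"
    have "?c * b0 \<in> R"
      using P b0 by (intro unital_subring_closed(4)[OF R] polys_over_coeff)
    moreover have "\<not> p dvd ?c * b0"
      using P b0 p by (simp add: prime_elem_dvd_mult_iff)
    ultimately obtain M where M: "\<And>l n y. M < l \<Longrightarrow> prime l \<Longrightarrow> y \<in> R \<Longrightarrow> \<not> p dvd (?c * b0) ^ n - of_nat l * y"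
      using sep unfolding prime_separated_def by metis
    show ?thesis
    proof (intro exI[of _ M] allI impI ballI notI)
      fix l n y assume l: "M < l" "prime l" and y: "y \<in> adjoin R x" and dvd: "p dvd b ^ n - of_nat l * y"
      have "p dvd b0 ^ n - (u * b) ^ n"
        using b0(4) by (metis dvd_trans dvd_triv_left power_diff_sumr2)
      moreover have "p dvd u ^ n * (b ^ n - of_nat l * y)" using dvd by simp
      ultimately have "p dvd b0 ^ n - (u * b) ^ n + u ^ n * (b ^ n - of_nat l * y)" by (rule dvd_add)
      then have b0n: "p dvd b0 ^ n - of_nat l * (u ^ n * y)"
        by (simp add: algebra_simps power_mult_distrib)
      have "u ^ n * y \<in> adjoin R x"
        using b0 y by (intro unital_subring_closed(4)[OF T] unital_subring_power[OF T])
      then obtain h where h: "h \<in> polys_over R" "u ^ n * y = poly h x" by (auto simp: adjoin_def)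
      obtain e q r where qr: "q \<in> polys_over R" "r \<in> polys_over R"
          "smult (?c ^ e) h = q * P + r" "degree r < degree P"
        using pseudo_division_over[OF R P(1) P_pos h(1)] by blast
      have eq: "?c ^ e * (u ^ n * y) = poly q x * poly P x + poly r x"
        using arg_cong[OF qr(3), of "\<lambda>g. poly g x"] h by simp
      define w where "w = [:?c ^ e * b0 ^ n:] - smult (of_nat l) r"
      have cR: "?c ^ k \<in> R" "b0 ^ k \<in> R" for k
        using P(1) b0 R by (auto intro: unital_subring_power polys_over_coeff)
      have "w \<in> polys_over R"
        unfolding w_def using R qr cR
        by (intro unital_subring_closed(3)[OF S] polys_over_smult polys_over_const
            unital_subring_of_nat unital_subring_closed(4)[OF R])
      moreover have "p dvd poly w x"
      proof -
        have r_eq: "poly r x = ?c ^ e * (u ^ n * y) - poly q x * poly P x" using eq by simp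
        have "poly w x = ?c ^ e * (b0 ^ n - of_nat l * (u ^ n * y)) + of_nat l * poly q x * poly P x"
          unfolding w_def poly_diff poly_smult r_eq by (simp add: algebra_simps)
        then show ?thesis using b0n Px by simp
      qed
      moreover have "degree w < degree P"
        unfolding w_def using qr(4) P_pos by (intro degree_diff_less) (auto intro: le_less_trans[OF degree_smult_le])
      ultimately have "[:p:] dvd w" using min by blast
      then have "p dvd coeff w 0" by (simp add: const_poly_dvd_iff)
      then have "p dvd ?c ^ e * b0 ^ n - of_nat l * coeff r 0" by (simp add: w_def)
      \<comment> \<open>The exponents of c and b0 are made equal so that a power of the fixed element c * b0 appears.\<close>
      then have "p dvd (?c ^ n * b0 ^ e) * (?c ^ e * b0 ^ n - of_nat l * coeff r 0)" by simp
      then have "p dvd (?c * b0) ^ (e + n) - of_nat l * (?c ^ n * b0 ^ e * coeff r 0)"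
        by (simp add: algebra_simps power_mult_distrib power_add)
      moreover have "?c ^ n * b0 ^ e * coeff r 0 \<in> R"
        using cR qr polys_over_coeff by (intro unital_subring_closed(4)[OF R])
      ultimately show False using M l by blast
    qed
  qed
qed

lemma prime_separated_generators:
  fixes p :: "'a::idom"
  assumes "prime_elem p" and "\<And>n. n > 0 \<Longrightarrow> \<not> p dvd of_nat n" and "finite S"
  shows "\<exists>R. unital_subring R \<and> S \<subseteq> R \<and> prime_separated p R"
  using assms(3)
proof induction
  case empty
  have "unital_subring (range of_int :: 'a set)"
    unfolding unital_subring_def
    by (auto simp flip: of_int_diff of_int_mult) (metis of_int_1 rangeI)
  then show ?case using prime_separated_integers[OF assms(2)] by blast
next
  case (insert x S)
  then show ?case
    using adjoin_superset unital_subring_adjoin prime_separated_adjoin[OF _ assms(1)] by (metis insert_subset subset_trans)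
qed

section \<open>The factorial functional on high powers\<close>

text \<open>
  The linear functional \<open>s^i \<mapsto> i!\<close>, over the reals the integral of \<open>g(s) exp(-s)\<close> over the
  positive half-line.
\<close>
definition factorial_functional :: "'a::comm_ring_1 poly \<Rightarrow> 'a"
  where "factorial_functional g = (\<Sum>i\<le>degree g. of_nat (fact i) * coeff g i)"

lemma factorial_functional_altdef:
  assumes "degree g \<le> n"
  shows "factorial_functional g = (\<Sum>i\<le>n. of_nat (fact i) * coeff g i)"
  unfolding factorial_functional_def using assms
  by (intro sum.mono_neutral_left) (auto simp: coeff_eq_0)

lemma factorial_functional_add:
  "factorial_functional (f + g) = factorial_functional f + factorial_functional g"
proof -
  define n where "n = max (degree f) (degree g)"
  have "degree f \<le> n" "degree g \<le> n" "degree (f + g) \<le> n"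
    by (auto simp: n_def degree_add_le)
  then show ?thesis
    by (simp add: factorial_functional_altdef[of _ n] sum.distrib distrib_left)
qed

lemma factorial_functional_smult:
  "factorial_functional (smult c f) = c * factorial_functional f"
  by (simp add: factorial_functional_altdef[of _ "degree f"] degree_smult_le sum_distrib_left mult.left_commute)

lemma dvd_factorial_functional: "[:c:] dvd g \<Longrightarrow> c dvd factorial_functional g"
  by (auto elim!: dvdE simp: factorial_functional_smult)

text \<open>
  Modulo \<open>l\<close> the \<open>l\<close>-th power of \<open>h\<close> is a polynomial in \<open>s^l\<close>, because its derivative
  \<open>l h^(l-1) h'\<close> vanishes. A Bezout relation between \<open>j\<close> and \<open>l\<close> cancels the factor \<open>j\<close> that the
  derivative introduces, without dividing in \<open>R\<close>.
\<close>
lemma coeff_prime_power_mod: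
  fixes h :: "'a::idom poly"
  assumes R: "unital_subring R" and h: "h \<in> polys_over R" and l: "prime l" "\<not> l dvd j"
  shows "\<exists>y\<in>R. coeff (h ^ l) j = of_nat l * y"
proof -
  note S = unital_subring_polys_over[OF R]
  obtain i where j: "j = Suc i" using l(2) by (cases j) auto
  define z where "z = coeff (h ^ (l - 1) * pderiv h) i"
  have z: "z \<in> R" unfolding z_def
    using h R by (intro polys_over_coeff unital_subring_closed(4)[OF S] unital_subring_power[OF S] polys_over_pderiv)
  have "of_nat j * coeff (h ^ l) j = coeff (pderiv (h ^ l)) i"
    by (simp add: coeff_pderiv j del: of_nat_Suc)
  also have "\<dots> = of_nat l * z"
    using prime_gt_0_nat[OF l(1)] pderiv_power_Suc[of h "l - 1"]
    by (simp add: z_def del: of_nat_Suc)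
  finally have z_eq: "of_nat j * coeff (h ^ l) j = of_nat l * z" .
  have "coprime (int j) (int l)"
    using l prime_imp_coprime_nat coprime_commute by (metis coprime_int_iff)
  then obtain u v where "int j * u + int l * v = 1"
    by (metis bezout_int mult.commute coprime_iff_gcd_eq_1)
  then have "of_int (int j * u + int l * v) = (1 :: 'a)" by simp
  then have uv: "of_nat j * of_int u + of_nat l * of_int v = (1 :: 'a)" by simp
  let ?c = "coeff (h ^ l) j"
  have "?c = (of_nat j * of_int u + of_nat l * of_int v) * ?c" by (simp add: uv)
  also have "\<dots> = of_int u * (of_nat j * ?c) + of_nat l * (of_int v * ?c)" by (simp add: algebra_simps)
  also have "\<dots> = of_nat l * (of_int u * z + of_int v * ?c)" by (simp add: z_eq algebra_simps)
  finally have "?c = of_nat l * (of_int u * z + of_int v * ?c)" .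
  moreover have "of_int u * z + of_int v * ?c \<in> R"
    using R z h by (intro unital_subring_closed(4,6)[OF R] unital_subring_of_int polys_over_coeff unital_subring_power[OF S])
  ultimately show ?thesis by blast
qed

text \<open>
  Only the lowest term survives modulo \<open>l\<close> after division by \<open>(r l)!\<close>. A term with \<open>j > 0\<close>
  divisible by \<open>l\<close> picks up the factor \<open>r l + l\<close> in its factorial, and for all other \<open>j > 0\<close> the
  coefficient of \<open>h^l\<close> is itself divisible by \<open>l\<close>.
\<close>
lemma factorial_functional_prime_power:
  fixes h :: "'a::idom poly"
  assumes R: "unital_subring R" and h: "h \<in> polys_over R" and l: "prime l"
  shows "\<exists>y\<in>R. factorial_functional ((monom 1 r * h) ^ l) =
           of_nat (fact (r * l)) * (coeff h 0 ^ l - of_nat l * y)"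
proof -
  let ?H = "h ^ l" and ?n = "r * l"
  note S = unital_subring_polys_over[OF R]
  have HR: "coeff ?H j \<in> R" for j
    using h by (intro polys_over_coeff unital_subring_power[OF S])
  have step: "\<exists>y\<in>R. of_nat (fact (?n + j)) * coeff ?H j = of_nat (fact ?n) * (of_nat l * y)" if "j > 0" for j
  proof (cases "l dvd j")
    case True
    have "fact ?n * l dvd (fact (?n + j) :: nat)"
    proof -
      have l0: "l > 0" using l by (rule prime_gt_0_nat)
      have "(fact ?n :: nat) dvd fact (?n + l - 1)" using l0 by (intro fact_dvd) simp
      moreover have "l dvd ?n + l" by simp
      ultimately have "l * fact ?n dvd (?n + l) * fact (?n + l - 1)" by (rule mult_dvd_mono[rotated])
      also have "\<dots> = fact (?n + l)" using l0 by (simp add: fact_reduce)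
      also have "\<dots> dvd fact (?n + j)" using True that by (intro fact_dvd) (auto dest: dvd_imp_le)
      finally show ?thesis by (simp add: mult.commute)
    qed
    then obtain k where "(fact (?n + j) :: nat) = fact ?n * l * k" by (auto elim!: dvdE)
    then have "of_nat (fact (?n + j)) * coeff ?H j = of_nat (fact ?n) * (of_nat l * (of_nat k * coeff ?H j))"
      by (simp only: of_nat_mult mult.assoc)
    then show ?thesis using HR unital_subring_closed(4)[OF R] unital_subring_of_nat[OF R] by blast
  next
    case False
    obtain y where y: "y \<in> R" "coeff ?H j = of_nat l * y"
      using coeff_prime_power_mod[OF R h l False] by blast
    have "(fact ?n :: nat) dvd fact (?n + j)" by (intro fact_dvd) simp
    then obtain k where "(fact (?n + j) :: nat) = fact ?n * k" by (auto elim!: dvdE)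
    then have "of_nat (fact (?n + j)) * coeff ?H j = of_nat (fact ?n) * (of_nat l * (of_nat k * y))"
      unfolding y(2) by (simp only: of_nat_mult mult_ac)
    then show ?thesis using y unital_subring_closed(4)[OF R] unital_subring_of_nat[OF R] by blast
  qed
  then obtain Y where Y: "\<And>j. j > 0 \<Longrightarrow> Y j \<in> R"
      "\<And>j. j > 0 \<Longrightarrow> of_nat (fact (?n + j)) * coeff ?H j = of_nat (fact ?n) * (of_nat l * Y j)"
    by metis
  define N where "N = degree ?H"
  have pow: "(monom 1 r * h) ^ l = monom 1 ?n * ?H"
    by (simp add: power_mult_distrib monom_power mult.commute)
  have "degree (monom 1 ?n * ?H) \<le> ?n + N"
    unfolding N_def using degree_mult_le[of "monom 1 ?n" ?H] degree_monom_le[of "1::'a" ?n] by linarith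
  then have "factorial_functional ((monom 1 r * h) ^ l) =
      (\<Sum>i\<le>?n + N. of_nat (fact i) * coeff (monom 1 ?n * ?H) i)"
    unfolding pow by (rule factorial_functional_altdef)
  also have "\<dots> = (\<Sum>i\<in>{?n..?n + N}. of_nat (fact i) * coeff ?H (i - ?n))"
    by (intro sum.mono_neutral_cong_right) (auto simp: coeff_monom_mult)
  also have "\<dots> = (\<Sum>j\<le>N. of_nat (fact (?n + j)) * coeff ?H j)"
    by (rule sum.reindex_bij_witness[of _ "\<lambda>j. ?n + j" "\<lambda>i. i - ?n"]) auto
  also have "\<dots> = of_nat (fact ?n) * coeff ?H 0 + (\<Sum>j\<in>{1..N}. of_nat (fact (?n + j)) * coeff ?H j)"
    by (simp add: sum.atMost_shift sum.atLeast1_atMost_eq atLeast0LessThan del: of_nat_mult fact_Suc)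
  also have "(\<Sum>j\<in>{1..N}. of_nat (fact (?n + j)) * coeff ?H j) =
      of_nat (fact ?n) * (of_nat l * (\<Sum>j\<in>{1..N}. Y j))"
    using Y(2) by (simp add: sum_distrib_left)
  also have "coeff ?H 0 = coeff h 0 ^ l" by (simp flip: poly_0_coeff_0)
  finally have "factorial_functional ((monom 1 r * h) ^ l) =
      of_nat (fact ?n) * (coeff h 0 ^ l - of_nat l * - (\<Sum>j\<in>{1..N}. Y j))"
    by (simp add: algebra_simps)
  moreover have "- (\<Sum>j\<in>{1..N}. Y j) \<in> R"
    using Y(1) by (intro unital_subring_closed(5)[OF R] unital_subring_sum[OF R]) auto
  ultimately show ?thesis by blast
qed

text \<open>
  The one-variable factorial conjecture over the domain \<open>A/p\<close>: a polynomial over a domain of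
  characteristic zero is zero if the functional kills all its high powers. Otherwise write it as
  \<open>s^r h\<close> with \<open>h(0) \<noteq> 0\<close>. For every large prime \<open>l\<close>, the value at the \<open>l\<close>-th power puts
  \<open>h(0)^l\<close> into the ideal \<open>(l)\<close> of the ring generated by the coefficients, which separation of
  primes forbids.
\<close>
lemma factorial_functional_powers:
  fixes p :: "'a::idom"
  assumes p: "prime_elem p" and char0: "\<And>n. n > 0 \<Longrightarrow> \<not> p dvd of_nat n"
    and vanish: "\<And>m. m \<ge> N \<Longrightarrow> p dvd factorial_functional (g ^ m)"
  shows "[:p:] dvd g"
proof (rule ccontr)
  assume "\<not> [:p:] dvd g"
  then have ex: "\<exists>i. \<not> p dvd coeff g i" by (simp add: const_poly_dvd_iff)
  define r where "r = (LEAST i. \<not> p dvd coeff g i)"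
  have r: "\<not> p dvd coeff g r" unfolding r_def using ex by (rule LeastI_ex)
  have below: "p dvd coeff g i" if "i < r" for i
    using not_less_Least[of i "\<lambda>i. \<not> p dvd coeff g i"] that by (auto simp: r_def)
  define h where "h = poly_shift r g"
  let ?f = "monom 1 r * h"
  have "[:p:] dvd g - ?f"
    using below by (auto simp: const_poly_dvd_iff coeff_monom_mult h_def coeff_poly_shift)
  obtain R where R: "unital_subring R" "range (coeff g) \<subseteq> R" "prime_separated p R"
  proof -
    have "range (coeff g) \<subseteq> insert 0 (coeff g ` {..degree g})"
      by (auto simp: coeff_eq_0) (metis atMost_iff coeff_eq_0 imageI not_le)
    then have "finite (range (coeff g))" by (rule finite_subset) simp
    then show thesis using prime_separated_generators[OF p char0] that by metis
  qed
  have h: "h \<in> polys_over R"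
    using R(2) by (auto simp: h_def polys_over_def coeff_poly_shift)
  have h0: "coeff h 0 = coeff g r" by (simp add: h_def coeff_poly_shift)
  obtain M where M: "\<And>l n y. M < l \<Longrightarrow> prime l \<Longrightarrow> y \<in> R \<Longrightarrow> \<not> p dvd coeff h 0 ^ n - of_nat l * y"
    using R r h0 unfolding prime_separated_def by (metis range_subsetD)
  obtain l :: nat where l: "prime l" "l > max M N" using bigger_prime by blast
  obtain y where y: "y \<in> R" "factorial_functional (?f ^ l) = of_nat (fact (r * l)) * (coeff h 0 ^ l - of_nat l * y)"
    using factorial_functional_prime_power[OF R(1) h l(1)] by blast
  have "[:p:] dvd g ^ l - ?f ^ l"
    using \<open>[:p:] dvd g - ?f\<close> by (metis dvd_trans dvd_triv_left power_diff_sumr2)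
  then have "p dvd factorial_functional (g ^ l - ?f ^ l)" by (rule dvd_factorial_functional)
  moreover have "factorial_functional (g ^ l) = factorial_functional (g ^ l - ?f ^ l) + factorial_functional (?f ^ l)"
    by (simp flip: factorial_functional_add)
  moreover have "p dvd factorial_functional (g ^ l)" using vanish l by simp
  ultimately have "p dvd factorial_functional (?f ^ l)" by (metis dvd_add_right_iff)
  moreover have "\<not> p dvd of_nat (fact (r * l))" by (rule char0) simp
  ultimately have "p dvd coeff h 0 ^ l - of_nat l * y"
    unfolding y(2) using p by (metis prime_elem_dvd_mult_iff)
  then show False using M[of l y l] l y by simp
qed

section \<open>Membership in the image of the operator\<close>

text \<open>
  For \<open>n \<ge> deg g\<close> this is \<open>a^n g(s/a)\<close>, with the denominators cleared. The exponent \<open>n\<close> is a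
  parameter because degree bounds add up when polynomials are multiplied.
\<close>
definition rescale :: "'a::comm_ring_1 \<Rightarrow> nat \<Rightarrow> 'a poly \<Rightarrow> 'a poly"
  where "rescale a n g = (\<Sum>i\<le>n. monom (coeff g i * a ^ (n - i)) i)"

lemma coeff_rescale: "coeff (rescale a n g) i = (if i \<le> n then coeff g i * a ^ (n - i) else 0)"
  by (simp add: rescale_def coeff_sum)

lemma pcompose_rescale:
  assumes "degree g \<le> n"
  shows "pcompose (rescale a n g) [:0, a:] = smult (a ^ n) g"
proof (rule poly_eqI)
  fix i
  show "coeff (pcompose (rescale a n g) [:0, a:]) i = coeff (smult (a ^ n) g) i"
  proof (cases "i \<le> n")
    case True
    then have "a ^ i * a ^ (n - i) = a ^ n" by (simp flip: power_add)
    then show ?thesis using True by (simp add: coeff_pcompose_linear coeff_rescale mult.left_commute mult.commute)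
  next
    case False
    then show ?thesis using assms by (simp add: coeff_pcompose_linear coeff_rescale coeff_eq_0)
  qed
qed

lemma rescale_mult:
  fixes a :: "'a::idom"
  assumes a: "a \<noteq> 0" and deg: "degree g \<le> n" "degree h \<le> m"
  shows "rescale a (n + m) (g * h) = rescale a n g * rescale a m h"
proof -
  have "degree (g * h) \<le> n + m" using degree_mult_le[of g h] deg by linarith
  then have eq: "pcompose (rescale a (n + m) (g * h)) [:0, a:] = pcompose (rescale a n g * rescale a m h) [:0, a:]"
    using deg by (simp add: pcompose_rescale pcompose_mult power_add mult_ac)
  show ?thesis
  proof (rule poly_eqI)
    fix i
    show "coeff (rescale a (n + m) (g * h)) i = coeff (rescale a n g * rescale a m h) i"
      using arg_cong[OF eq, of "\<lambda>g. coeff g i"] a by (simp add: coeff_pcompose_linear)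
  qed
qed

lemma rescale_power:
  fixes a :: "'a::idom"
  assumes a: "a \<noteq> 0" and deg: "degree f \<le> d"
  shows "rescale a (d * m) (f ^ m) = rescale a d f ^ m"
proof (induction m)
  case 0
  show ?case by (rule poly_eqI) (simp add: coeff_rescale)
next
  case (Suc m)
  have "degree (f ^ m) \<le> d * m"
    using degree_power_le[of f m] deg by (meson le_trans mult_le_mono1)
  then show ?case using rescale_mult[OF a deg] Suc by simp
qed

lemma factorial_functional_rescale:
  "factorial_functional (rescale a n g) = (\<Sum>i\<le>n. of_nat (fact i) * (coeff g i * a ^ (n - i)))"
proof -
  have "degree (rescale a n g) \<le> n" by (rule degree_le) (simp add: coeff_rescale)
  then show ?thesis by (simp add: factorial_functional_altdef coeff_rescale)
qed

lemma coeff_deriv_minus: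
  "coeff (deriv_minus a h) i = of_nat (Suc i) * coeff h (Suc i) - a * coeff h i"
  by (simp add: deriv_minus_def coeff_pderiv del: of_nat_Suc)

lemma deriv_minus_diff: "deriv_minus a (f - g) = deriv_minus a f - deriv_minus a g"
  by (simp add: deriv_minus_def pderiv_diff smult_diff_right)

text \<open>
  Over the fraction field, the rescaled functional of \<open>g\<close> is \<open>a^(n+1)\<close> times the Laplace
  transform of \<open>g\<close> at \<open>a\<close>, and integration by parts gives the transform of \<open>h' - a h\<close> as
  \<open>- h(0)\<close>. Here integration by parts appears as a telescoping sum.
\<close>
lemma range_deriv_minus_imp_dvd:
  fixes a :: "'a::idom"
  assumes a: "a \<noteq> 0" and deg: "degree (deriv_minus a h) \<le> n"
  shows "a ^ Suc n dvd factorial_functional (rescale a n (deriv_minus a h))"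
proof -
  have "coeff (deriv_minus a h) (degree h) \<noteq> 0 \<or> h = 0"
    using a by (auto simp: coeff_deriv_minus coeff_eq_0 simp del: of_nat_Suc)
  then have "degree h \<le> n" using le_degree deg by fastforce
  have "(\<Sum>i\<le>k. of_nat (fact i) * (coeff (deriv_minus a h) i * a ^ (n - i))) =
      of_nat (fact (Suc k)) * coeff h (Suc k) * a ^ (n - k) - coeff h 0 * a ^ Suc n"
    if "k \<le> n" for k using that
  proof (induction k)
    case 0
    show ?case by (simp add: coeff_deriv_minus algebra_simps)
  next
    case (Suc k)
    then have "a ^ (n - k) = a * a ^ (n - Suc k)"
      by (metis Suc_diff_Suc Suc_le_lessD power_Suc)
    moreover have "of_nat (fact (Suc (Suc k))) = of_nat (Suc (Suc k)) * (of_nat (fact (Suc k)) :: 'a)"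
      by (simp only: fact_Suc of_nat_mult of_nat_id)
    ultimately show ?case
      using Suc by (simp add: coeff_deriv_minus algebra_simps del: fact_Suc of_nat_Suc)
  qed
  from this[of n] have "factorial_functional (rescale a n (deriv_minus a h)) = - coeff h 0 * a ^ Suc n"
    using \<open>degree h \<le> n\<close> by (simp add: factorial_functional_rescale coeff_eq_0)
  then show ?thesis by simp
qed

text \<open>
  Conversely, the divisibility forces the top coefficient to be a multiple \<open>a c\<close> of \<open>a\<close>,
  since factorials are units. Adding the image of \<open>c t^(n+1)\<close> removes it, lowers the degree bound,
  and divides the rescaled functional by \<open>a\<close>.
\<close>
lemma dvd_imp_range_deriv_minus:
  fixes a :: "'a::idom"
  assumes unit: "\<And>n. n > 0 \<Longrightarrow> of_nat n dvd (1 :: 'a)" and a: "a \<noteq> 0"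
    and "degree g \<le> n" and "a ^ Suc n dvd factorial_functional (rescale a n g)"
  shows "g \<in> range (deriv_minus a)"
  using assms(3,4)
proof (induction n arbitrary: g)
  case 0
  then obtain b where b: "g = [:b:]" by (metis degree_0_id le_zero_eq)
  with 0 have "a dvd b" by (simp add: factorial_functional_rescale)
  then obtain c where "b = a * c" by (elim dvdE)
  then have "g = deriv_minus a [:- c:]" by (simp add: b deriv_minus_def)
  then show ?case by blast
next
  case (Suc n)
  let ?S = "\<Sum>i\<le>n. of_nat (fact i) * (coeff g i * a ^ (n - i))"
  have power_split: "a ^ (Suc n - i) = a * a ^ (n - i)" if "i \<le> n" for i
    using that by (simp add: Suc_diff_le)
  have sum_eq: "factorial_functional (rescale a (Suc n) g) = a * ?S + of_nat (fact (Suc n)) * coeff g (Suc n)"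
    unfolding factorial_functional_rescale sum.atMost_Suc
    by (simp add: power_split sum_distrib_left mult.left_commute del: fact_Suc)
  have "a dvd factorial_functional (rescale a (Suc n) g)"
    using Suc.prems(2) by (metis dvd_trans dvd_triv_left power_Suc)
  then have "a dvd of_nat (fact (Suc n)) * coeff g (Suc n)"
    unfolding sum_eq by (metis dvd_add_right_iff dvd_triv_left)
  moreover obtain w where w: "of_nat (fact (Suc n)) * w = (1 :: 'a)"
    using unit[of "fact (Suc n)"] by (metis dvdE fact_gt_zero)
  ultimately have "a dvd coeff g (Suc n)"
    by (metis dvd_mult mult.commute mult.left_commute mult_1)
  then obtain c where c: "coeff g (Suc n) = a * c" by (elim dvdE)
  define g' where "g' = g + deriv_minus a (monom c (Suc n))"
  have coeff_g': "coeff g' i = (if i = n then coeff g n + of_nat (Suc n) * c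
      else if i = Suc n then 0 else coeff g i)" for i
    by (simp add: g'_def coeff_deriv_minus c del: of_nat_Suc)
  have "degree g' \<le> n"
    using Suc.prems(1) by (intro degree_le) (auto simp: coeff_g' coeff_eq_0)
  moreover have "a ^ Suc n dvd factorial_functional (rescale a n g')"
  proof -
    have "factorial_functional (rescale a n g') = ?S + of_nat (fact n) * (of_nat (Suc n) * c)"
      by (cases n) (simp_all add: factorial_functional_rescale coeff_g' algebra_simps del: fact_Suc of_nat_Suc)
    then have "a * factorial_functional (rescale a n g') = factorial_functional (rescale a (Suc n) g)"
      by (simp add: sum_eq c fact_Suc algebra_simps)
    then show ?thesis using Suc.prems(2) a by (metis dvd_mult_cancel_left power_Suc)
  qed
  ultimately have "g' \<in> range (deriv_minus a)" by (rule Suc.IH)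
  then obtain h where "g' = deriv_minus a h" by blast
  then have "g = deriv_minus a (h - monom c (Suc n))"
    by (simp add: g'_def deriv_minus_diff algebra_simps)
  then show ?case by blast
qed

lemma surj_deriv_minus_0:
  assumes unit: "\<And>n. n > 0 \<Longrightarrow> of_nat n dvd (1 :: 'a::idom)"
  shows "range (deriv_minus (0 :: 'a)) = UNIV"
proof -
  have "\<forall>n. \<exists>y :: 'a. of_nat (Suc n) * y = 1"
    using unit[OF zero_less_Suc] unfolding dvd_def by (metis (no_types))
  then obtain c :: "nat \<Rightarrow> 'a" where c: "\<And>n. of_nat (Suc n) * c n = 1"
    using choice[of "\<lambda>n y. of_nat (Suc n) * y = (1 :: 'a)"] by blast
  have "g = deriv_minus 0 (\<Sum>i\<le>degree g. monom (coeff g i * c i) (Suc i))" for g :: "'a poly"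
  proof (rule poly_eqI)
    fix k
    have "of_nat (Suc k) * (b * c k) = b" for b
      using c[of k] by (simp add: mult.left_commute del: of_nat_Suc)
    then show "coeff g k = coeff (deriv_minus 0 (\<Sum>i\<le>degree g. monom (coeff g i * c i) (Suc i))) k"
      by (simp add: coeff_deriv_minus coeff_sum coeff_eq_0 del: of_nat_Suc)
  qed
  then show ?thesis by blast
qed

section \<open>The radical of the image and the Mathieu property\<close>

text \<open>
  Extract from \<open>F\<close> the largest power \<open>p^\<mu>\<close>, say \<open>F = p^\<mu> G\<close>. If \<open>\<mu> \<le> d e\<close>, then the
  \<open>\<mu> m\<close> factors \<open>p\<close> removed from \<open>F^m\<close> are fewer than the \<open>e (d m + 1)\<close> factors supplied by
  \<open>a\<close>, so \<open>p\<close> still divides the functional at \<open>G^m\<close>. Then \<open>p\<close> divides \<open>G\<close>, against the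
  choice of \<open>\<mu>\<close>.
\<close>
lemma prime_power_dvd_rescale:
  fixes a p :: "'a::idom"
  assumes p: "prime_elem p" and char0: "\<And>n. n > 0 \<Longrightarrow> \<not> p dvd of_nat n"
    and e: "e > 0" "p ^ e dvd a"
    and F: "\<And>m. m \<ge> N \<Longrightarrow> a ^ Suc (d * m) dvd factorial_functional (F ^ m)"
  shows "[:p ^ Suc (d * e):] dvd F"
proof (rule ccontr)
  assume not: "\<not> [:p ^ Suc (d * e):] dvd F"
  define k where "k = (LEAST k. \<not> [:p ^ k:] dvd F)"
  have k: "\<not> [:p ^ k:] dvd F" and "k \<le> Suc (d * e)"
    unfolding k_def using not by (rule LeastI, rule Least_le)
  have "k \<noteq> 0"
  proof
    assume "k = 0"
    then show False using k by (simp flip: one_pCons)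
  qed
  then obtain \<mu> where \<mu>: "k = Suc \<mu>" by (cases k) auto
  then have "\<mu> \<le> d * e" using \<open>k \<le> Suc (d * e)\<close> by simp
  have "[:p ^ \<mu>:] dvd F"
    using not_less_Least[of \<mu> "\<lambda>k. \<not> [:p ^ k:] dvd F"] \<mu> by (simp add: k_def)
  then obtain G where G: "F = smult (p ^ \<mu>) G" by (auto elim!: dvdE)
  have "p dvd factorial_functional (G ^ m)" if m: "m \<ge> N" for m
  proof -
    have "\<mu> * m \<le> d * e * m" using \<open>\<mu> \<le> d * e\<close> by (rule mult_le_mono1)
    moreover have "e * Suc (d * m) = e + d * e * m" by simp
    ultimately have "\<mu> * m + 1 \<le> e * Suc (d * m)" using e(1) by linarith
    then have "p ^ (\<mu> * m + 1) dvd (p ^ e) ^ Suc (d * m)"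
      unfolding power_mult[symmetric] by (rule le_imp_power_dvd)
    also have "\<dots> dvd a ^ Suc (d * m)" using e(2) by (rule dvd_power_same)
    also have "\<dots> dvd factorial_functional (F ^ m)" using m by (rule F)
    also have "\<dots> = p ^ (\<mu> * m) * factorial_functional (G ^ m)"
      by (simp add: G smult_power power_mult factorial_functional_smult flip: power_mult)
    finally show ?thesis using prime_elem_not_zeroI p by (auto simp: prime_elem_def)
  qed
  then have "[:p:] dvd G" using factorial_functional_powers[OF p char0] by blast
  then have "[:p:] * [:p ^ \<mu>:] dvd G * [:p ^ \<mu>:]" by (rule mult_dvd_mono) simp
  then have "[:p ^ k:] dvd F" by (simp add: G \<mu> mult.commute)
  then show False using k by contradiction
qed

lemma of_nat_unit_if_rat_algebra:
  assumes "commutative_algebra (qscale :: rat \<Rightarrow> 'a::comm_ring_1 \<Rightarrow> 'a)" and "n > 0"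
  shows "of_nat n dvd (1 :: 'a)"
proof -
  interpret commutative_algebra qscale by (rule assms)
  have eq: "qscale (of_nat k) 1 = of_nat k" for k
    by (induction k) (auto simp: scale_left_distrib)
  have "1 = qscale (of_nat n * inverse (of_nat n)) 1" using assms(2) by simp
  also have "\<dots> = qscale (of_nat n) (1 * qscale (inverse (of_nat n)) 1)" by (simp only: scale_scale mult_1)
  also have "\<dots> = of_nat n * qscale (inverse (of_nat n)) 1" by (simp only: scale_mult_left eq)
  finally show ?thesis by (rule dvdI)
qed

theorem theorem7p1:
  fixes qscale :: "rat \<Rightarrow> 'a::{idom_divide,factorial_semiring} \<Rightarrow> 'a"
    and a :: 'a
  assumes "commutative_algebra qscale"
  shows "commutative_algebra.mathieu_subspace smult (range (deriv_minus a))"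
proof -
  interpret poly_alg: commutative_algebra "smult :: 'a \<Rightarrow> 'a poly \<Rightarrow> 'a poly"
    by (rule commutative_algebra_smult)
  interpret D: module_hom smult smult "deriv_minus a" by (rule module_hom_deriv_minus)
  let ?V = "range (deriv_minus a)"
  have unit: "of_nat n dvd (1 :: 'a)" if "n > 0" for n
    using assms that by (rule of_nat_unit_if_rat_algebra)
  have subspace: "poly_alg.subspace ?V" by (rule D.subspace_image[OF poly_alg.subspace_UNIV])
  have "\<exists>M. \<forall>m\<ge>M. f ^ m * g \<in> ?V" if f: "f \<in> radical_set ?V" for f g
  proof (cases "a = 0")
    case True
    then show ?thesis using surj_deriv_minus_0[OF unit] by simp
  next
    case a: False
    obtain N where N: "\<And>m. m \<ge> N \<Longrightarrow> f ^ m \<in> ?V" using f by (auto simp: radical_set_def)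
    define d k F where "d = degree f" and "k = degree g" and "F = rescale a d f"
    have deg: "degree (f ^ m) \<le> d * m" for m
      using degree_power_le[of f m] by (simp add: d_def)
    have F: "a ^ Suc (d * m) dvd factorial_functional (F ^ m)" if m: "m \<ge> N" for m
    proof -
      obtain h where "f ^ m = deriv_minus a h" using N[OF m] by blast
      then show ?thesis
        using range_deriv_minus_imp_dvd[OF a, of h "d * m"] deg[of m] rescale_power[OF a, of f d m]
        by (simp add: F_def d_def)
    qed
    \<comment> \<open>Each prime p of a with multiplicity e divides F^m at least (d e + 1) m times, whereas
      e (d m + k + 1) times suffice; the difference is nonnegative once m is at least e (k + 1).
      The number of prime factors of a bounds all e at once.\<close>
    have dvd_coeff: "a ^ Suc (d * m + k) dvd coeff (F ^ m) i"
      if m: "m \<ge> Suc k * size (prime_factorization a)" for m i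
    proof (cases "coeff (F ^ m) i = 0")
      case False
      show ?thesis
      proof (rule multiplicity_le_imp_dvd)
        fix p :: 'a assume p: "prime p"
        define e where "e = multiplicity p a"
        have mult_pow: "multiplicity p (a ^ Suc (d * m + k)) = Suc (d * m + k) * e"
          unfolding e_def using p a by (intro prime_elem_multiplicity_power_distrib) auto
        show "multiplicity p (a ^ Suc (d * m + k)) \<le> multiplicity p (coeff (F ^ m) i)"
        proof (cases "e = 0")
          case True
          then show ?thesis using mult_pow by simp
        next
          case e: False
          have char0: "\<not> p dvd of_nat n" if "n > 0" for n
            using unit[OF that] p by (meson dvd_trans not_prime_unit)
          have "[:p ^ Suc (d * e):] dvd F"
            using p e F char0 by (intro prime_power_dvd_rescale[where a = a and N = N]) (auto simp: e_def multiplicity_dvd)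
          then have "[:p ^ Suc (d * e):] ^ m dvd F ^ m" by (rule dvd_power_same)
          then have "p ^ (Suc (d * e) * m) dvd coeff (F ^ m) i"
            unfolding power_mult by (simp add: poly_const_pow const_poly_dvd_iff del: power_Suc)
          then have "Suc (d * e) * m \<le> multiplicity p (coeff (F ^ m) i)"
            using False p by (intro multiplicity_geI) auto
          moreover have "e \<le> size (prime_factorization a)"
            using p count_le_size[of "prime_factorization a" p] by (simp add: e_def count_prime_factorization_prime)
          then have "Suc k * e \<le> m" using m by (meson le_trans mult_le_mono2)
          then have "Suc (d * m + k) * e \<le> Suc (d * e) * m" by (simp add: algebra_simps)
          ultimately show ?thesis using mult_pow by linarith
        qed
      qed (use a in simp)
    qed simp
    have "f ^ m * g \<in> ?V" if m: "m \<ge> Suc k * size (prime_factorization a)" for m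
    proof (rule dvd_imp_range_deriv_minus[OF unit a])
      show "degree (f ^ m * g) \<le> d * m + k"
        using degree_mult_le[of "f ^ m" g] deg[of m] by (simp add: k_def)
      have "rescale a (d * m + k) (f ^ m * g) = F ^ m * rescale a k g"
        using rescale_mult[OF a deg, of g k m] rescale_power[OF a, of f d m] by (simp add: F_def d_def k_def)
      moreover have "[:a ^ Suc (d * m + k):] dvd F ^ m"
        using dvd_coeff[OF m] by (simp add: const_poly_dvd_iff del: power_Suc)
      ultimately show "a ^ Suc (d * m + k) dvd factorial_functional (rescale a (d * m + k) (f ^ m * g))"
        by (intro dvd_factorial_functional) simp
    qed
    then show ?thesis by blast
  qed
  then show ?thesis using subspace unfolding poly_alg.mathieu_subspace_def by blast
qed

end
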